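(* Let $\mathcal Z(n)$, $n\in\mathbb N$, be as in the context. There exist a $56$-element set $\mathcal Z_{\mathrm{super}}=\{\zeta_1,\ldots,\zeta_{56}\}$ (of pairs of words) and $277$ subsets $\mathcal Z_1,\ldots,\mathcal Z_{277}\subset\mathcal Z_{\mathrm{super}}$ such that for every $n\in\mathbb N$ there is $q\in\{1,\ldots,277\}$ with $\mathcal Z(n)=\mathcal Z_q$.
   Context: The Tribonacci word $\mathbf t$ is the fixed point of $\varphi:0\mapsto01,\ 1\mapsto02,\ 2\mapsto0$. Tribonacci numbers: $T_0=T_1=0$, $T_2=1$, $T_j=T_{j-1}+T_{j-2}+T_{j-3}$. $\Psi(w)=(|w|_0,|w|_1,|w|_2)$ is the Parikh vector. For words $v,w$ with $\Psi(v)=\Psi(w)$, factorize $v=z_0\cdots z_h$, $w=\tilde z_0\cdots\tilde z_h$ with nonempty $z_j,\tilde z_j$, $\Psi(z_j)=\Psi(\tilde z_j)$, $h$ maximal; $\mathrm{Dec}\binom{v}{w}=\{\binom{z_j}{\tilde z_j}:0\le j\le h\}$. $x^{-1}y$ denotes $y$ with its prefix $x$ deleted. With $\mathbf t_{[n]}$ the length-$n$ prefix of $\mathbf t$, define $\mathcal Z(n)=\mathrm{Dec}\binom{\varphi^{K+3}(0)}{\mathbf t_{[n]}^{-1}\varphi^{K+3}(0)\mathbf t_{[n]}}$ for any integer $K\ge0$ with $n\le T_{K+3}$ (independent of such $K$). *)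

theory Defs
  imports Main "HOL-Library.Stream"
begin

section \<open>The Tribonacci word\<close>

datatype letter = L0 | L1 | L2

type_synonym word = "letter list"

fun tau :: "letter \<Rightarrow> word" where
  "tau L0 = [L0, L1]"
| "tau L1 = [L0, L2]"
| "tau L2 = [L0]"

definition phi :: "word \<Rightarrow> word" where
  "phi w = concat (map tau w)"

text \<open>The extension of the substitution to right-infinite words is \<open>flat \<circ> smap tau\<close>.\<close>

definition tribonacci_word :: "letter stream" where
  "tribonacci_word = (THE s. flat (smap tau s) = s)"

fun trib :: "nat \<Rightarrow> nat" where
  "trib 0 = 0"
| "trib (Suc 0) = 0"
| "trib (Suc (Suc 0)) = 1"
| "trib (Suc (Suc (Suc j))) = trib (Suc (Suc j)) + trib (Suc j) + trib j"

section \<open>Decomposition of a pair of words\<close>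

definition parikh :: "word \<Rightarrow> nat \<times> nat \<times> nat" where
  "parikh w = (count_list w L0, count_list w L1, count_list w L2)"

definition factorization :: "word \<Rightarrow> word \<Rightarrow> (word \<times> word) list \<Rightarrow> bool" where
  "factorization v w zs \<longleftrightarrow>
     concat (map fst zs) = v \<and> concat (map snd zs) = w \<and>
     (\<forall>(z, z') \<in> set zs. z \<noteq> [] \<and> z' \<noteq> [] \<and> parikh z = parikh z')"

definition max_factorization :: "word \<Rightarrow> word \<Rightarrow> (word \<times> word) list \<Rightarrow> bool" where
  "max_factorization v w zs \<longleftrightarrow>
     factorization v w zs \<and> (\<forall>ys. factorization v w ys \<longrightarrow> length ys \<le> length zs)"

text \<open>Meaningful for \<open>parikh v = parikh w\<close>; see \<open>ex1_max_factorization\<close> below.\<close>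

definition Dec :: "word \<Rightarrow> word \<Rightarrow> (word \<times> word) set" where
  "Dec v w = set (THE zs. max_factorization v w zs)"

text \<open>Meaningful only if \<open>x\<close> is a prefix of \<open>y\<close>.\<close>

definition left_quotient :: "word \<Rightarrow> word \<Rightarrow> word" where
  "left_quotient x y = drop (length x) y"

definition Z_at :: "nat \<Rightarrow> nat \<Rightarrow> (word \<times> word) set" where
  "Z_at K n =
     Dec ((phi ^^ (K + 3)) [L0])
         (left_quotient (stake n tribonacci_word) ((phi ^^ (K + 3)) [L0])
            @ stake n tribonacci_word)"

text \<open>The least admissible \<open>K\<close> is taken only for definiteness; by \<open>calZ_eq\<close> below every
  admissible \<open>K\<close> gives the same set.\<close>

text \<open>The index is meant to be positive. The set \<open>calZ 0\<close> consists of the pairs \<open>([a], [a])\<close> only and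
  differs from every \<open>calZ n\<close> with \<open>n \<ge> 1\<close>.\<close>

definition calZ :: "nat \<Rightarrow> (word \<times> word) set" where
  "calZ n = Z_at (LEAST K. n \<le> trib (K + 3)) n"

section \<open>Well-definedness\<close>

lemma parikh_append_cancel:
  assumes "parikh (a @ b) = parikh (c @ d)" "parikh a = parikh c"
  shows "parikh b = parikh d"
  using assms by (auto simp: parikh_def)

lemma parikh_append_cong:
  assumes "parikh a = parikh c" "parikh b = parikh d"
  shows "parikh (a @ b) = parikh (c @ d)"
  using assms by (auto simp: parikh_def)

lemma length_parikh: "length w = count_list w L0 + count_list w L1 + count_list w L2"
proof (induction w)
  case (Cons a w)
  then show ?case by (cases a) auto
qed auto

lemma parikh_length: "parikh v = parikh w \<Longrightarrow> length v = length w"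
  by (simp add: length_parikh parikh_def)

lemma factorization_Nil [simp]: "factorization v w [] \<longleftrightarrow> v = [] \<and> w = []"
  by (auto simp: factorization_def)

lemma factorization_Cons:
  "factorization v w ((a, a') # zs) \<longleftrightarrow>
     a \<noteq> [] \<and> a' \<noteq> [] \<and> parikh a = parikh a' \<and>
     (\<exists>v' w'. v = a @ v' \<and> w = a' @ w' \<and> factorization v' w' zs)"
  by (auto simp: factorization_def)

lemma factorization_append:
  "factorization v w zs \<Longrightarrow> factorization v' w' zs' \<Longrightarrow> factorization (v @ v') (w @ w') (zs @ zs')"
  by (auto simp: factorization_def)

lemma factorization_parikh: "factorization v w zs \<Longrightarrow> parikh v = parikh w"
proof (induction zs arbitrary: v w)
  case (Cons p zs)
  obtain a a' where "p = (a, a')" by force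
  with Cons show ?case by (auto simp: factorization_Cons intro: parikh_append_cong)
qed auto

lemma factorization_length: "factorization v w zs \<Longrightarrow> length zs \<le> length v"
proof (induction zs arbitrary: v w)
  case (Cons p zs)
  obtain a a' where p: "p = (a, a')" by force
  from Cons.prems obtain v' w' where *: "a \<noteq> []" "v = a @ v'" "factorization v' w' zs"
    by (auto simp: factorization_Cons p)
  have "length a \<ge> 1" using *(1) by (cases a) auto
  with Cons.IH[OF *(3)] *(2) show ?case by simp
qed auto

lemma ex_factorization:
  assumes "parikh v = parikh w"
  shows "\<exists>zs. factorization v w zs"
proof (cases "v = []")
  case True
  with parikh_length[OF assms] show ?thesis by (intro exI[of _ "[]"]) auto
next
  case False
  with parikh_length[OF assms] have "w \<noteq> []" by auto
  with False assms have "factorization v w [(v, w)]" by (auto simp: factorization_Cons)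
  then show ?thesis ..
qed

lemma ex_max_factorization:
  assumes "parikh v = parikh w"
  shows "\<exists>zs. max_factorization v w zs"
proof -
  obtain z0 where z0: "factorization v w z0" using ex_factorization[OF assms] ..
  have "\<exists>zs. factorization v w zs \<and> (\<forall>ys. factorization v w ys \<longrightarrow> length ys \<le> length zs)"
    by (rule ex_has_greatest_nat[of "factorization v w" z0 length "Suc (length v)"])
       (use z0 factorization_length in \<open>auto simp: less_Suc_eq_le\<close>)
  then show ?thesis by (simp add: max_factorization_def)
qed

lemma max_factorization_tl:
  assumes "max_factorization (a @ v) (a' @ w) ((a, a') # zs)"
  shows "max_factorization v w zs"
  unfolding max_factorization_def
proof (intro conjI allI impI)
  show "factorization v w zs"
    using assms by (auto simp: max_factorization_def factorization_Cons)
next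
  fix ys assume "factorization v w ys"
  then have "factorization (a @ v) (a' @ w) ((a, a') # ys)"
    using assms by (auto simp: max_factorization_def factorization_Cons)
  then show "length ys \<le> length zs"
    using assms by (fastforce simp: max_factorization_def)
qed

lemma max_factorization_hd_le:
  assumes m: "max_factorization (v1 @ v2) (w1 @ w2) ((a, a') # zs)"
    and p: "parikh v1 = parikh w1" and ne: "v1 \<noteq> []"
  shows "length a \<le> length v1"
proof (rule ccontr)
  assume "\<not> length a \<le> length v1"
  then have lt: "length v1 < length a" by simp
  from m obtain v' w' where *: "a \<noteq> []" "a' \<noteq> []" "parikh a = parikh a'"
    "v1 @ v2 = a @ v'" "w1 @ w2 = a' @ w'" "factorization v' w' zs"
    by (auto simp: max_factorization_def factorization_Cons)
  have l1: "length v1 = length w1" "length a = length a'"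
    using p *(3) by (auto dest: parikh_length)
  obtain c where c: "a = v1 @ c" using *(4) lt by (auto simp: append_eq_append_conv2)
  obtain c' where c': "a' = w1 @ c'" using *(5) lt l1 by (auto simp: append_eq_append_conv2)
  have pc: "parikh c = parikh c'" using *(3) p parikh_append_cancel unfolding c c' by blast
  have "c \<noteq> []" "c' \<noteq> []" "w1 \<noteq> []" using lt l1 c c' ne by auto
  with p ne pc *(6) have "factorization (v1 @ c @ v') (w1 @ c' @ w') ((v1, w1) # (c, c') # zs)"
    by (auto simp: factorization_Cons)
  moreover have "v1 @ v2 = v1 @ c @ v'" "w1 @ w2 = w1 @ c' @ w'"
    using *(4,5) c c' by auto
  ultimately show False using m by (fastforce simp: max_factorization_def)
qed

lemma max_factorization_unique:
  "max_factorization v w zs \<Longrightarrow> max_factorization v w ys \<Longrightarrow> zs = ys"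
proof (induction zs arbitrary: v w ys)
  case Nil
  then have "length ys \<le> length ([] :: (word \<times> word) list)"
    unfolding max_factorization_def by blast
  then show ?case by simp
next
  case (Cons p zs)
  obtain a a' where p: "p = (a, a')" by force
  have "length (p # zs) \<le> length ys" using Cons.prems unfolding max_factorization_def by blast
  then obtain b b' ys' where ys: "ys = (b, b') # ys'" by (cases ys) auto
  obtain v1 w1 where 1: "v = a @ v1" "w = a' @ w1" "parikh a = parikh a'" "a \<noteq> []"
    using Cons.prems(1) by (auto simp: p max_factorization_def factorization_Cons)
  obtain v2 w2 where 2: "v = b @ v2" "w = b' @ w2" "parikh b = parikh b'" "b \<noteq> []"
    using Cons.prems(2) by (auto simp: ys max_factorization_def factorization_Cons)
  have "length a \<le> length b"
    using max_factorization_hd_le[of b v2 b' w2 a a' zs] Cons.prems(1) 2 p by simp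
  moreover have "length b \<le> length a"
    using max_factorization_hd_le[of a v1 a' w1 b b' ys'] Cons.prems(2) 1 ys by simp
  ultimately have l: "length a = length b" by simp
  then have l': "length a' = length b'" using parikh_length[OF 1(3)] parikh_length[OF 2(3)] by simp
  have e: "a = b" "a' = b'" "v1 = v2" "w1 = w2" using 1 2 l l' by auto
  have "zs = ys'"
    using Cons.IH[of v1 w1 ys'] max_factorization_tl[of a v1 a' w1] Cons.prems 1 2 e p ys by simp
  then show ?case using e p ys by simp
qed

lemma ex1_max_factorization:
  "parikh v = parikh w \<Longrightarrow> \<exists>!zs. max_factorization v w zs"
  using ex_max_factorization max_factorization_unique by blast

lemma Dec_eq: "max_factorization v w zs \<Longrightarrow> Dec v w = set zs"
  unfolding Dec_def using max_factorization_unique by (metis the_equality)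

lemma max_factorization_split:
  "max_factorization (v1 @ v2) (w1 @ w2) zs \<Longrightarrow> parikh v1 = parikh w1 \<Longrightarrow>
    \<exists>xs ys. zs = xs @ ys \<and> factorization v1 w1 xs \<and> factorization v2 w2 ys"
proof (induction zs arbitrary: v1 w1)
  case Nil
  then show ?case by (auto simp: max_factorization_def)
next
  case (Cons p zs)
  show ?case
  proof (cases "v1 = []")
    case True
    then have "w1 = []" using Cons.prems(2) parikh_length by fastforce
    with True Cons.prems show ?thesis
      by (intro exI[of _ "[]"] exI[of _ "p # zs"]) (auto simp: max_factorization_def)
  next
    case False
    obtain a a' where p: "p = (a, a')" by force
    have le: "length a \<le> length v1"
      using max_factorization_hd_le Cons.prems False p by blast
    obtain v' w' where *: "a \<noteq> []" "a' \<noteq> []" "parikh a = parikh a'"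
      "v1 @ v2 = a @ v'" "w1 @ w2 = a' @ w'"
      using Cons.prems(1) by (auto simp: p max_factorization_def factorization_Cons)
    have l: "length a = length a'" "length v1 = length w1"
      using *(3) Cons.prems(2) by (auto dest: parikh_length)
    obtain c where c: "v1 = a @ c" using *(4) le by (auto simp: append_eq_append_conv2)
    obtain c' where c': "w1 = a' @ c'" using *(5) le l by (auto simp: append_eq_append_conv2)
    have pc: "parikh c = parikh c'"
      using Cons.prems(2) *(3) parikh_append_cancel unfolding c c' by blast
    have "max_factorization (c @ v2) (c' @ w2) zs"
      using Cons.prems(1) max_factorization_tl[of a "c @ v2" a' "c' @ w2" zs] by (simp add: p c c')
    from Cons.IH[OF this pc] obtain xs ys
      where "zs = xs @ ys" "factorization c c' xs" "factorization v2 w2 ys" by blast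
    then show ?thesis
      using * c c' p by (intro exI[of _ "p # xs"] exI[of _ ys]) (auto simp: factorization_Cons)
  qed
qed

lemma Dec_append:
  assumes "parikh v1 = parikh w1" "parikh v2 = parikh w2"
  shows "Dec (v1 @ v2) (w1 @ w2) = Dec v1 w1 \<union> Dec v2 w2"
proof -
  obtain zs where zs: "max_factorization (v1 @ v2) (w1 @ w2) zs"
    using ex_max_factorization[OF parikh_append_cong[OF assms]] ..
  obtain xs ys where xy: "zs = xs @ ys" "factorization v1 w1 xs" "factorization v2 w2 ys"
    using max_factorization_split[OF zs assms(1)] by blast
  have "length us \<le> length xs" if "factorization v1 w1 us" for us
    using factorization_append[OF that xy(3)] zs xy(1) by (fastforce simp: max_factorization_def)
  then have "max_factorization v1 w1 xs" using xy(2) by (simp add: max_factorization_def)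
  moreover have "length us \<le> length ys" if "factorization v2 w2 us" for us
    using factorization_append[OF xy(2) that] zs xy(1) by (fastforce simp: max_factorization_def)
  then have "max_factorization v2 w2 ys" using xy(3) by (simp add: max_factorization_def)
  ultimately show ?thesis using zs xy(1) by (simp add: Dec_eq)
qed

lemma phi_append [simp]: "phi (v @ w) = phi v @ phi w"
  by (simp add: phi_def)

lemma phi_pow_append: "(phi ^^ k) (v @ w) = (phi ^^ k) v @ (phi ^^ k) w"
  by (induction k) auto

lemma phi_pow_rec:
  "(phi ^^ (k + 3)) [L0] = (phi ^^ (k + 2)) [L0] @ (phi ^^ (k + 1)) [L0] @ (phi ^^ k) [L0]"
proof -
  have "(phi ^^ (k + 3)) [L0] = (phi ^^ k) ((phi ^^ 3) [L0])"
    by (simp only: funpow_add comp_def)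
  also have "(phi ^^ 3) [L0] = (phi ^^ 2) [L0] @ (phi ^^ 1) [L0] @ [L0]"
    by (simp add: phi_def eval_nat_numeral)
  finally show ?thesis
    by (simp only: phi_pow_append funpow_add comp_def)
qed

lemma length_phi_pow: "length ((phi ^^ k) [L0]) = trib (k + 3)"
proof (induction k rule: less_induct)
  case (less k)
  consider "k = 0" | "k = 1" | "k = 2" | j where "k = j + 3"
    by (metis One_nat_def Suc_1 add.commute less_2_cases_iff le_Suc_ex linorder_not_less
        less_antisym eval_nat_numeral(3) numeral_3_eq_3)
  then show ?case
  proof cases
    case 4
    have "trib (k + 3) = trib (j + 5) + trib (j + 4) + trib (j + 3)"
      using 4 by (simp add: eval_nat_numeral)
    moreover have "length ((phi ^^ (j + 2)) [L0]) = trib (j + 5)"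
      "length ((phi ^^ (j + 1)) [L0]) = trib (j + 4)" "length ((phi ^^ j) [L0]) = trib (j + 3)"
      using less[of "j + 2"] less[of "j + 1"] less[of j] 4 by (simp_all add: eval_nat_numeral)
    ultimately show ?thesis unfolding 4 phi_pow_rec by simp
  qed (auto simp: phi_def eval_nat_numeral)
qed

lemma hd_tau: "\<exists>u. tau a = L0 # u"
  by (cases a) auto

lemma tau_ne [simp]: "tau a \<noteq> []"
  by (cases a) auto

lemma phi_pow_Suc_prefix: "\<exists>u. (phi ^^ Suc k) [L0] = (phi ^^ k) [L0] @ u \<and> u \<noteq> []"
proof -
  have ne: "(phi ^^ k) [L1] \<noteq> []"
  proof (induction k)
    case (Suc k)
    then obtain x xs where "(phi ^^ k) [L1] = x # xs" by (cases "(phi ^^ k) [L1]") auto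
    moreover have "phi (x # xs) \<noteq> []" by (simp add: phi_def)
    ultimately show ?case by simp
  qed simp
  have "(phi ^^ Suc k) [L0] = (phi ^^ k) ([L0] @ [L1])"
    by (simp add: funpow_Suc_right phi_def del: funpow.simps)
  then show ?thesis unfolding phi_pow_append using ne by blast
qed

lemma phi_pow_prefix:
  assumes "k \<le> m" shows "\<exists>u. (phi ^^ m) [L0] = (phi ^^ k) [L0] @ u"
  using assms
proof (induction m rule: dec_induct)
  case (step m)
  then show ?case using phi_pow_Suc_prefix[of m] by auto
qed simp

lemma phi_pow_length_gt: "k < length ((phi ^^ k) [L0])"
proof (induction k)
  case (Suc k)
  obtain u where "(phi ^^ Suc k) [L0] = (phi ^^ k) [L0] @ u" "u \<noteq> []"
    using phi_pow_Suc_prefix by blast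
  then have "length ((phi ^^ Suc k) [L0]) = length ((phi ^^ k) [L0]) + length u" "length u > 0"
    by (simp_all only: length_append length_greater_0_conv not_False_eq_True)
  with Suc show ?case by linarith
qed simp

lemma flat_smap_shift: "flat (smap tau (w @- s)) = phi w @- flat (smap tau s)"
  by (induction w) (auto simp: phi_def)

lemma fixed_point_prefix:
  assumes "flat (smap tau s) = s" shows "\<exists>r. s = (phi ^^ k) [L0] @- r"
proof (induction k)
  case 0
  obtain u where "tau (shd s) = L0 # u" using hd_tau by blast
  then have "shd (flat (smap tau s)) = L0" by simp
  then have "shd s = L0" using assms by simp
  then show ?case by (intro exI[of _ "stl s"]) (metis funpow_0 shift.simps stream.collapse)
next
  case (Suc k)
  then show ?case using assms flat_smap_shift by (metis comp_apply funpow.simps(2))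
qed

lemma ex1_fixed_point: "\<exists>!s. flat (smap tau s) = s"
proof (rule ex_ex1I)
  define s where "s = smap (\<lambda>i. (phi ^^ i) [L0] ! i) nats"
  have s: "s !! i = (phi ^^ i) [L0] ! i" for i by (simp add: s_def)
  have nth: "s !! i = (phi ^^ k) [L0] ! i" if "i < length ((phi ^^ k) [L0])" for i k
  proof (cases "i \<le> k")
    case True
    from phi_pow_prefix[OF True] show ?thesis using phi_pow_length_gt[of i] s
      by (auto simp: nth_append)
  next
    case False
    then have "k \<le> i" by simp
    from phi_pow_prefix[OF this] show ?thesis using that s by (auto simp: nth_append)
  qed
  have "\<exists>r. s = (phi ^^ k) [L0] @- r" for k
  proof -
    have "stake (length ((phi ^^ k) [L0])) s = (phi ^^ k) [L0]"
      by (rule nth_equalityI) (auto simp: nth)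
    then show ?thesis by (metis stake_sdrop)
  qed
  note pre = this
  have "flat (smap tau s) !! i = s !! i" for i
  proof -
    obtain r where "s = (phi ^^ i) [L0] @- r" using pre by blast
    then have "flat (smap tau s) = (phi ^^ Suc i) [L0] @- flat (smap tau r)"
      using flat_smap_shift by simp
    moreover have "i < length ((phi ^^ Suc i) [L0])" using phi_pow_length_gt[of "Suc i"] by linarith
    ultimately show ?thesis using nth[of i "Suc i"] by (metis shift_snth_less)
  qed
  then have "flat (smap tau s) = s" by (metis (no_types) smap_alt stream.map_ident)
  then show "\<exists>s. flat (smap tau s) = s" ..
next
  fix s s' assume "flat (smap tau s) = s" "flat (smap tau s') = s'"
  then have "s !! i = s' !! i" for i
    using fixed_point_prefix[of s i] fixed_point_prefix[of s' i] phi_pow_length_gt[of i]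
    by (metis shift_snth_less)
  then show "s = s'" by (metis (no_types) smap_alt stream.map_ident)
qed

lemma tribonacci_word_fixed_point: "flat (smap tau tribonacci_word) = tribonacci_word"
  unfolding tribonacci_word_def by (rule theI'[OF ex1_fixed_point])

lemma stake_tribonacci_word:
  assumes "n \<le> length ((phi ^^ k) [L0])"
  shows "stake n tribonacci_word = take n ((phi ^^ k) [L0])"
proof -
  obtain r where "tribonacci_word = (phi ^^ k) [L0] @- r"
    using fixed_point_prefix[OF tribonacci_word_fixed_point] by blast
  with assms show ?thesis by (metis append_Nil2 diff_is_0_eq stake.simps(1) stake_shift)
qed

lemma Z_at_Suc:
  assumes "n \<le> trib (K + 3)"
  shows "Z_at (Suc K) n = Z_at K n"
proof -
  define u where "u = stake n tribonacci_word"
  define P where "P k = (phi ^^ k) [L0]" for k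
  define C where "C k = left_quotient u (P k) @ u" for k
  define D where "D k = Dec (P k) (C k)" for k
  have P3: "P (k + 3) = P (k + 2) @ P (k + 1) @ P k" for k
    unfolding P_def by (rule phi_pow_rec)
  have pre: "\<exists>x. P k = u @ x" if le: "K \<le> k" for k
  proof -
    obtain y where "P k = P K @ y" using phi_pow_prefix[OF le] unfolding P_def by blast
    moreover have "u = take n (P K)"
      using stake_tribonacci_word assms length_phi_pow unfolding u_def P_def by simp
    ultimately show ?thesis by (metis append.assoc append_take_drop_id)
  qed
  have par: "parikh (P k) = parikh (C k)" if "K \<le> k" for k
    using pre[OF that] by (auto simp: C_def left_quotient_def parikh_def)
  have D3: "D (k + 3) = D (k + 2) \<union> D (k + 1) \<union> D k" if "K \<le> k" for k
  proof -
    have "\<exists>x. P k = u @ x" "\<exists>x. P (k + 1) = u @ x" "\<exists>x. P (k + 2) = u @ x"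
      using pre that by (simp_all del: One_nat_def)
    then have C3: "C (k + 3) = C (k + 2) @ C (k + 1) @ C k"
      unfolding C_def P3 left_quotient_def by auto
    have "parikh (P (k + 1) @ P k) = parikh (C (k + 1) @ C k)"
      using that by (intro parikh_append_cong par) auto
    then show ?thesis
      unfolding D_def P3 C3 using that by (simp add: Dec_append par Un_assoc)
  qed
  have "D (Suc K + 3) = D (K + 3)"
    using D3[of K] D3[of "Suc K"] by (auto simp: eval_nat_numeral)
  then show ?thesis by (simp add: Z_at_def D_def C_def P_def u_def)
qed

lemma trib_mono: "j \<le> k \<Longrightarrow> trib (j + 3) \<le> trib (k + 3)"
  using phi_pow_prefix[of j k] by (metis length_append length_phi_pow le_add1)

theorem calZ_eq:
  assumes "n \<le> trib (K + 3)"
  shows "calZ n = Z_at K n"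
proof -
  define K0 where "K0 = (LEAST K. n \<le> trib (K + 3))"
  have K0: "n \<le> trib (K0 + 3)" "K0 \<le> K"
    unfolding K0_def using assms by (auto intro: LeastI Least_le)
  from K0(2) have "Z_at K n = Z_at K0 n"
  proof (induction K rule: dec_induct)
    case (step m)
    have "n \<le> trib (m + 3)" using K0(1) trib_mono[of K0 m] step.hyps by linarith
    with step Z_at_Suc show ?case by simp
  qed simp
  then show ?thesis by (simp add: calZ_def K0_def)
qed

lemma ex_admissible: "\<exists>K. n \<le> trib (K + 3)"
  using phi_pow_length_gt[of n] length_phi_pow[of n] by (metis less_imp_le)

end

theory Submission
  imports Defs "HOL-Library.While_Combinator"
begin

text \<open>
  Every prefix of the Tribonacci word of length at least \<open>2\<close> has the form \<open>\<phi>(u)\<close> or \<open>\<phi>(u)0\<close> for a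
  shorter nonempty prefix \<open>u\<close>. Since \<open>Dec\<close> is compatible with concatenation, \<open>Z(|\<phi>(u)|)\<close> is obtained
  from \<open>Z(|u|)\<close> by decomposing all pairs \<open>(\<phi>(z), \<phi>(z'))\<close>, and \<open>Z(|\<phi>(u)| + 1)\<close> by decomposing all
  pairs \<open>(\<phi>(z), \<psi>(z'))\<close>, where \<open>\<psi>(a) = 0\<^sup>-\<^sup>1\<phi>(a)0\<close>. The closure of \<open>Z(1)\<close> under these two maps
  is finite: it consists of \<open>277\<close> sets built from \<open>56\<close> pairs, as a graph search confirms.
\<close>

section \<open>Graph search\<close>

datatype trie = Tip | Branch bool trie trie

fun trie_mem :: "bool list \<Rightarrow> trie \<Rightarrow> bool" where
  "trie_mem k Tip = False"
| "trie_mem [] (Branch b l r) = b"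
| "trie_mem (True # k) (Branch b l r) = trie_mem k l"
| "trie_mem (False # k) (Branch b l r) = trie_mem k r"

fun trie_ins :: "bool list \<Rightarrow> trie \<Rightarrow> trie" where
  "trie_ins [] Tip = Branch True Tip Tip"
| "trie_ins (True # k) Tip = Branch False (trie_ins k Tip) Tip"
| "trie_ins (False # k) Tip = Branch False Tip (trie_ins k Tip)"
| "trie_ins [] (Branch b l r) = Branch True l r"
| "trie_ins (True # k) (Branch b l r) = Branch b (trie_ins k l) r"
| "trie_ins (False # k) (Branch b l r) = Branch b l (trie_ins k r)"

fun trie_of :: "('a \<Rightarrow> bool list) \<Rightarrow> 'a list \<Rightarrow> trie" where
  "trie_of key [] = Tip"
| "trie_of key (x # xs) = trie_ins (key x) (trie_of key xs)"

lemma trie_mem_Cons: "trie_mem (a # k) (Branch b l r) = trie_mem k (if a then l else r)"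
  by (cases a) auto

lemma trie_mem_ins: "trie_mem k (trie_ins k' t) \<longleftrightarrow> k = k' \<or> trie_mem k t"
proof (induction k' t arbitrary: k rule: trie_ins.induct)
  case 1 show ?case by (cases k) (auto simp: trie_mem_Cons)
next
  case 2 then show ?case by (cases k) (auto simp: trie_mem_Cons)
next
  case 3 then show ?case by (cases k) (auto simp: trie_mem_Cons)
next
  case 4 show ?case by (cases k) (auto simp: trie_mem_Cons)
next
  case 5 then show ?case by (cases k) (auto simp: trie_mem_Cons)
next
  case 6 then show ?case by (cases k) (auto simp: trie_mem_Cons)
qed

lemma trie_mem_trie_of: "inj key \<Longrightarrow> trie_mem (key y) (trie_of key xs) \<longleftrightarrow> y \<in> set xs"
  by (induction xs) (auto simp: trie_mem_ins inj_eq)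

text \<open>A search state consists of the worklist, the visited keys, and the list of visited nodes.\<close>

fun visit :: "('a \<Rightarrow> bool list) \<Rightarrow> 'a list \<Rightarrow> 'a list \<times> trie \<times> 'a list \<Rightarrow> 'a list \<times> trie \<times> 'a list" where
  "visit key [] s = s"
| "visit key (y # ys) (ws, t, zs) =
     visit key ys (if trie_mem (key y) t then (ws, t, zs)
                   else (y # ws, trie_ins (key y) t, y # zs))"

fun pending :: "'a list \<times> trie \<times> 'a list \<Rightarrow> bool" where
  "pending ([], _) = False"
| "pending (_ # _, _) = True"

fun explore_step ::
  "('a \<Rightarrow> bool list) \<Rightarrow> ('a \<Rightarrow> 'a list) \<Rightarrow> 'a list \<times> trie \<times> 'a list \<Rightarrow> 'a list \<times> trie \<times> 'a list" where
  "explore_step key f (w # ws, t, zs) = visit key (f w) (ws, t, zs)"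
| "explore_step key f ([], t, zs) = ([], t, zs)"

text \<open>With \<open>while_option\<close> termination need not be proved beforehand: a result
  \<open>Some\<close> already certifies that the worklist ran empty.\<close>

definition explore ::
  "('a \<Rightarrow> bool list) \<Rightarrow> ('a \<Rightarrow> 'a list) \<Rightarrow> 'a \<Rightarrow> ('a list \<times> trie \<times> 'a list) option" where
  "explore key f x = while_option pending (explore_step key f) ([x], trie_ins (key x) Tip, [x])"

text \<open>The conjunct \<open>set zs' \<subseteq> set zs \<union> set ws'\<close> records that
  every node found for the first time is put on the worklist.\<close>

lemma visit_invariant:
  assumes "inj key" "visit key ys (ws, t, zs) = (ws', t', zs')"
    and "distinct zs" "set ws \<subseteq> set zs" "\<And>y. trie_mem (key y) t \<longleftrightarrow> y \<in> set zs"
  shows "distinct zs' \<and> set ws \<subseteq> set ws' \<and> set ws' \<subseteq> set zs' \<and> set zs' = set zs \<union> set ys \<and>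
    set zs' \<subseteq> set zs \<union> set ws' \<and> (\<forall>y. trie_mem (key y) t' \<longleftrightarrow> y \<in> set zs')"
  using assms(2-)
proof (induction ys arbitrary: ws t zs)
  case (Cons y ys)
  show ?case
  proof (cases "y \<in> set zs")
    case True
    then show ?thesis using Cons.IH[of ws t zs] Cons.prems by auto
  next
    case False
    have "distinct (y # zs)" "set (y # ws) \<subseteq> set (y # zs)"
      "visit key ys (y # ws, trie_ins (key y) t, y # zs) = (ws', t', zs')"
      "\<And>z. trie_mem (key z) (trie_ins (key y) t) \<longleftrightarrow> z \<in> set (y # zs)"
      using False Cons.prems by (auto simp: trie_mem_ins inj_eq[OF assms(1)])
    note IH = Cons.IH[OF this(3,1,2,4)]
    show ?thesis
      by (intro conjI; use IH in \<open>elim conjE\<close>) (assumption | simp | blast)+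
  qed
qed auto

text \<open>Throughout the loop a visited node is on the worklist or has all its successors visited.
  On exit the worklist is empty, so the visited nodes are closed under \<open>f\<close>.\<close>

lemma explore_Some:
  assumes "inj key" "explore key f x = Some (ws, t, zs)"
  shows "distinct zs" "x \<in> set zs" "\<And>y. y \<in> set zs \<Longrightarrow> set (f y) \<subseteq> set zs"
proof -
  let ?P = "\<lambda>(ws, t, zs). distinct zs \<and> x \<in> set zs \<and> set ws \<subseteq> set zs \<and>
    (\<forall>y. trie_mem (key y) t \<longleftrightarrow> y \<in> set zs) \<and> (\<forall>y\<in>set zs. y \<in> set ws \<or> set (f y) \<subseteq> set zs)"
  have P: "?P (ws, t, zs)"
  proof (rule while_option_rule[OF _ assms(2)[unfolded explore_def]], goal_cases)
    case (1 s)
    obtain vs u ys where s: "s = (vs, u, ys)" by (cases s)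
    obtain v vs' where vs: "vs = v # vs'" using 1 s by (cases vs) auto
    obtain vs2 u2 ys2 where v: "visit key (f v) (vs', u, ys) = (vs2, u2, ys2)"
      by (cases "visit key (f v) (vs', u, ys)")
    have "distinct ys2 \<and> set vs' \<subseteq> set vs2 \<and> set vs2 \<subseteq> set ys2 \<and> set ys2 = set ys \<union> set (f v) \<and>
      set ys2 \<subseteq> set ys \<union> set vs2 \<and> (\<forall>y. trie_mem (key y) u2 \<longleftrightarrow> y \<in> set ys2)"
      by (rule visit_invariant[OF assms(1) v]) (use 1 in \<open>auto simp: s vs\<close>)
    moreover from this have "y \<in> set vs2 \<or> set (f y) \<subseteq> set ys2" if "y \<in> set ys2" for y
      using 1(1) that by (cases "y \<in> set ys"; cases "y = v") (auto simp: s vs)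
    ultimately show ?case using 1(1) unfolding s vs explore_step.simps v by simp blast
  qed (simp add: trie_mem_ins inj_eq[OF assms(1)])
  moreover have "ws = []"
    using while_option_stop[OF assms(2)[unfolded explore_def]] by (cases ws) auto
  ultimately show "distinct zs" "x \<in> set zs" "\<And>y. y \<in> set zs \<Longrightarrow> set (f y) \<subseteq> set zs"
    by auto
qed

section \<open>Decomposition under substitutions\<close>

text \<open>Greedy cutting: \<open>p\<close> and \<open>q\<close> hold the unfinished block, which
  is closed as soon as its Parikh vectors agree. The final clause drops the buffers; these are empty
  there if the words have equal Parikh vectors and the initial buffers are empty.\<close>

fun dec_from :: "word \<Rightarrow> word \<Rightarrow> word \<Rightarrow> word \<Rightarrow> (word \<times> word) list" where
  "dec_from p q (a # v) (b # w) =
     (if parikh (p @ [a]) = parikh (q @ [b]) then (p @ [a], q @ [b]) # dec_from [] [] v w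
      else dec_from (p @ [a]) (q @ [b]) v w)"
| "dec_from p q _ _ = []"

lemma Dec_Nil [simp]: "Dec [] [] = {}"
proof -
  have "max_factorization [] [] []"
    using factorization_length[of "[]" "[]"] by (auto simp: max_factorization_def)
  then show ?thesis by (simp add: Dec_eq)
qed

text \<open>The first block of a maximal factorization is a pair of nonempty prefixes with equal
  Parikh vectors; by \<open>irr\<close> it can only be the whole pair.\<close>

lemma Dec_irreducible:
  assumes "parikh v = parikh w" "v \<noteq> []"
    and irr: "\<And>k. 0 < k \<Longrightarrow> k < length v \<Longrightarrow> parikh (take k v) \<noteq> parikh (take k w)"
  shows "Dec v w = {(v, w)}"
proof -
  obtain zs where zs: "max_factorization v w zs"
    using ex_max_factorization[OF assms(1)] ..
  then have f: "factorization v w zs" by (simp add: max_factorization_def)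
  with assms(2) obtain a a' zs' where eq: "zs = (a, a') # zs'"
    by (cases zs) (auto simp: factorization_def)
  obtain v' w' where *: "a \<noteq> []" "parikh a = parikh a'" "v = a @ v'" "w = a' @ w'"
    "factorization v' w' zs'"
    using f by (auto simp: eq factorization_Cons)
  have "length a = length a'" using *(2) by (rule parikh_length)
  then have "take (length a) v = a" "take (length a) w = a'" using *(3,4) by simp_all
  with irr[of "length a"] *(1-3) have "v' = []" by fastforce
  with * have "zs' = []" using factorization_length[of v' w' zs'] by simp
  with * \<open>v' = []\<close> have "zs = [(v, w)]" by (auto simp: eq)
  with zs show ?thesis by (simp add: Dec_eq)
qed

text \<open>The third hypothesis excludes cuts inside the buffers. The first agreement therefore
  closes an irreducible pair, which \<open>Dec_append\<close> splits off.\<close>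

lemma Dec_eq_dec_from:
  assumes "parikh (p @ v) = parikh (q @ w)" "length p = length q"
    and "\<And>k. 0 < k \<Longrightarrow> k \<le> length p \<Longrightarrow> parikh (take k p) \<noteq> parikh (take k q)"
  shows "Dec (p @ v) (q @ w) = set (dec_from p q v w)"
  using assms
proof (induction p q v w rule: dec_from.induct)
  case (1 p q a v b w)
  have irr: "parikh (take k (p @ [a])) \<noteq> parikh (take k (q @ [b]))"
    if "0 < k" "k < length (p @ [a])" for k
    using 1(5)[of k] 1(4) that by simp
  show ?case
  proof (cases "parikh (p @ [a]) = parikh (q @ [b])")
    case True
    have vw: "parikh v = parikh w"
      using parikh_append_cancel[of "p @ [a]" v "q @ [b]" w] 1(3) True by simp
    have "Dec ((p @ [a]) @ v) ((q @ [b]) @ w) = {(p @ [a], q @ [b])} \<union> Dec v w"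
      unfolding Dec_append[OF True vw] using Dec_irreducible[OF True _ irr] by simp
    with 1(1)[OF True] vw True show ?thesis by simp
  next
    case False
    have "parikh (take k (p @ [a])) \<noteq> parikh (take k (q @ [b]))"
      if "0 < k" "k \<le> length (p @ [a])" for k
      using irr[of k] that False 1(4) by (cases "k = length (p @ [a])") auto
    with 1(2)[OF False] 1(3,4) False show ?thesis by simp
  qed
next
  case ("2_1" p q w)
  then have "w = []" using parikh_length[of "p @ []" "q @ w"] by simp
  \<comment> \<open>Both remaining words are empty, so \<open>p\<close> and \<open>q\<close> have
    equal Parikh vectors; a nonempty \<open>p\<close> would contradict the hypothesis at
    \<open>k = length p\<close>.\<close>
  with "2_1"(1,2) "2_1"(3)[of "length p"] have "p = []" by fastforce
  with "2_1"(2) \<open>w = []\<close> show ?case by simp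
next
  case ("2_2" p q v)
  then have "v = []" using parikh_length[of "p @ v" "q @ []"] by simp
  with "2_2"(1,2) "2_2"(3)[of "length p"] have "p = []" by fastforce
  with "2_2"(2) \<open>v = []\<close> show ?case by simp
qed

corollary Dec_code: "parikh v = parikh w \<Longrightarrow> Dec v w = set (dec_from [] [] v w)"
  using Dec_eq_dec_from[of "[]" v "[]" w] by simp

text \<open>By \<open>fg\<close> the images of a block again have equal Parikh vectors. The old cuts
  thus survive, and \<open>Dec_append\<close> lets each block be decomposed separately.\<close>

lemma Dec_hom:
  assumes f: "\<And>x y. f (x @ y) = f x @ f y" and g: "\<And>x y. g (x @ y) = g x @ g y"
    and fg: "\<And>x y. parikh x = parikh y \<Longrightarrow> parikh (f x) = parikh (g y)"
    and vw: "parikh v = parikh w"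
  shows "Dec (f v) (g w) = (\<Union>(z, z')\<in>Dec v w. set (dec_from [] [] (f z) (g z')))"
proof -
  have "f [] = []" "g [] = []" using f[of "[]" "[]"] g[of "[]" "[]"] by auto
  then have "Dec (f v) (g w) = (\<Union>(z, z')\<in>set zs. set (dec_from [] [] (f z) (g z')))"
    if "factorization v w zs" for zs
    using that
  proof (induction zs arbitrary: v w)
    case (Cons p zs)
    obtain a a' where p: "p = (a, a')" by force
    obtain v' w' where *: "parikh a = parikh a'" "v = a @ v'" "w = a' @ w'"
      "factorization v' w' zs"
      using Cons.prems by (auto simp: p factorization_Cons)
    have "Dec (f v) (g w) = set (dec_from [] [] (f a) (g a')) \<union> Dec (f v') (g w')"
      unfolding * f g using Dec_append[OF fg fg] Dec_code[OF fg] *(1) factorization_parikh[OF *(4)]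
      by metis
    with Cons.IH[OF \<open>f [] = []\<close> \<open>g [] = []\<close> *(4)] show ?case by (simp add: p)
  qed simp
  moreover obtain zs where "max_factorization v w zs"
    using ex_max_factorization[OF vw] ..
  ultimately show ?thesis by (simp add: Dec_eq max_factorization_def)
qed

definition psi :: "word \<Rightarrow> word" where
  "psi w = concat (map (\<lambda>a. tl (tau a) @ [L0]) w)"

lemma psi_append: "psi (v @ w) = psi v @ psi w"
  by (simp add: psi_def)

text \<open>Each \<open>tau a\<close> begins with \<open>L0\<close>, so a leading \<open>L0\<close>
  can be moved through the word letter by letter: \<open>psi\<close> is \<open>phi\<close>
  conjugated by \<open>L0\<close>.\<close>

lemma Cons_psi: "L0 # psi w = phi w @ [L0]"
proof (induction w)
  case (Cons a w)
  then show ?case by (cases a) (auto simp: psi_def phi_def)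
qed (simp add: psi_def phi_def)

text \<open>The right-hand side is the incidence matrix of the substitution applied to
  \<open>parikh w\<close>.\<close>

lemma parikh_phi:
  "parikh (phi w) =
    (count_list w L0 + count_list w L1 + count_list w L2, count_list w L0, count_list w L1)"
proof (induction w)
  case (Cons a w)
  then show ?case by (cases a) (auto simp: phi_def parikh_def)
qed (simp add: phi_def parikh_def)

lemma parikh_psi: "parikh (psi w) = parikh (phi w)"
  using parikh_append_cancel[of "[L0]" "psi w" "[L0]" "phi w"] Cons_psi[of w]
  by (auto simp: parikh_def)

lemma parikh_phi_cong: "parikh v = parikh w \<Longrightarrow> parikh (phi v) = parikh (phi w)"
  by (simp add: parikh_phi) (simp add: parikh_def)

definition phi_phi :: "word \<times> word \<Rightarrow> (word \<times> word) list" where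
  "phi_phi = (\<lambda>(z, z'). dec_from [] [] (phi z) (phi z'))"

definition phi_psi :: "word \<times> word \<Rightarrow> (word \<times> word) list" where
  "phi_psi = (\<lambda>(z, z'). dec_from [] [] (phi z) (psi z'))"

lemma Dec_phi_phi:
  "parikh v = parikh w \<Longrightarrow> Dec (phi v) (phi w) = (\<Union>z\<in>Dec v w. set (phi_phi z))"
  by (subst Dec_hom[of phi phi]) (auto simp: phi_phi_def intro: parikh_phi_cong)

lemma Dec_phi_psi:
  "parikh v = parikh w \<Longrightarrow> Dec (phi v) (psi w) = (\<Union>z\<in>Dec v w. set (phi_psi z))"
  by (subst Dec_hom[of phi psi]) (auto simp: parikh_psi psi_append phi_psi_def intro: parikh_phi_cong)

section \<open>Recurrences for the sets \<open>calZ n\<close>\<close>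

abbreviation pre :: "nat \<Rightarrow> word" where "pre n \<equiv> stake n tribonacci_word"

text \<open>If \<open>P (n + 3) = pre n @ x\<close>, then \<open>calZ n\<close> decomposes
  \<open>pre n @ x\<close> against \<open>x @ pre n\<close>. Applying \<open>phi\<close> to both
  words treats the prefix \<open>phi (pre n)\<close>; rotating by one further \<open>L0\<close>
  turns \<open>phi\<close> into \<open>psi\<close> in the second word.\<close>

lemma calZ_image_length:
  shows calZ_phi: "calZ (length (phi (pre n))) = (\<Union>z\<in>calZ n. set (phi_phi z))"
    and calZ_psi: "calZ (Suc (length (phi (pre n)))) = (\<Union>z\<in>calZ n. set (phi_psi z))"
proof -
  define P where "P k = (phi ^^ k) [L0]" for k
  have len: "length (P k) = trib (k + 3)" for k by (simp add: P_def length_phi_pow)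
  have lt: "n < length (P n)" unfolding P_def by (rule phi_pow_length_gt)
  obtain y where y: "P n = pre n @ y" "y \<noteq> []"
  proof
    show "P n = pre n @ drop n (P n)"
      using stake_tribonacci_word[of n n] lt by (simp add: P_def)
  qed (use lt in simp)
  obtain r where "P (n + 3) = P n @ r"
    using phi_pow_prefix[of n "n + 3"] by (auto simp: P_def)
  then obtain x where x: "P (n + 3) = pre n @ x" using y by simp
  have Zn: "calZ n = Dec (pre n @ x) (x @ pre n)"
    using calZ_eq[of n n] lt len x by (simp add: Z_at_def P_def left_quotient_def)
  have par: "parikh (pre n @ x) = parikh (x @ pre n)" by (simp add: parikh_def)
  have P1: "P (Suc n) = phi (pre n) @ phi y" using arg_cong[OF y(1), of phi] by (simp add: P_def)
  \<comment> \<open>As \<open>y\<close> is nonempty, \<open>phi y\<close> supplies the extra letter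
    \<open>L0\<close>, so \<open>K = Suc n\<close> is admissible for both lengths.\<close>
  obtain c where c: "phi y = L0 # c" using y(2) hd_tau[of "hd y"] by (cases y) (auto simp: phi_def)
  have P4: "P (Suc n + 3) = phi (pre n) @ phi x"
    using arg_cong[OF x, of phi] by (simp only: P_def add_Suc funpow.simps comp_apply phi_append)
  let ?N = "length (phi (pre n))"
  have N: "?N \<le> length (P (Suc n))" "Suc ?N \<le> length (P (Suc n))"
    using P1 c by simp_all
  have s: "pre ?N = phi (pre n)" "pre (Suc ?N) = phi (pre n) @ [L0]"
    using N[THEN stake_tribonacci_word[OF _, of _ "Suc n", folded P_def]] P1 c
    by (simp_all del: stake.simps)
  have "calZ ?N = Dec (phi (pre n @ x)) (phi (x @ pre n))"
    using calZ_eq[OF N(1)[unfolded len]] P4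
    unfolding Z_at_def P_def s left_quotient_def by simp
  with Dec_phi_phi[OF par] Zn show "calZ ?N = (\<Union>z\<in>calZ n. set (phi_phi z))" by simp
  \<comment> \<open>The longer prefix also takes away the leading \<open>L0\<close> of
    \<open>phi x\<close>, and this letter reappears at the end: the conjugation of
    \<open>Cons_psi\<close>.\<close>
  have "drop (Suc ?N) (phi (pre n) @ phi x) @ phi (pre n) @ [L0] = psi (x @ pre n)"
  proof -
    have "x \<noteq> []" using x lt \<open>P (n + 3) = P n @ r\<close> y by auto
    then obtain d where d: "phi x = L0 # d" using hd_tau[of "hd x"] by (cases x) (auto simp: phi_def)
    have "L0 # psi (x @ pre n) = phi (x @ pre n) @ [L0]" by (rule Cons_psi)
    with d show ?thesis by simp
  qed
  then have "calZ (Suc ?N) = Dec (phi (pre n @ x)) (psi (x @ pre n))"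
    using calZ_eq[OF N(2)[unfolded len]] P4
    unfolding Z_at_def P_def s left_quotient_def by simp
  with Dec_phi_psi[OF par] Zn show "calZ (Suc ?N) = (\<Union>z\<in>calZ n. set (phi_psi z))" by simp
qed

section \<open>Lengths of the images of prefixes\<close>

lemma length_phi_stake_Suc:
  "length (phi (pre (Suc m))) \<in> {Suc (length (phi (pre m))), Suc (Suc (length (phi (pre m))))}"
  by (cases "tribonacci_word !! m") (auto simp: stake_Suc phi_def simp del: stake.simps)

lemma pre_1: "pre (Suc 0) = [L0]"
  using stake_tribonacci_word[of 1 0] by simp

text \<open>This makes the recurrences usable in a strong induction on the index. At
  \<open>m = 0\<close> both sides are 0.\<close>

lemma length_phi_stake_gt: "m \<ge> 1 \<Longrightarrow> m < length (phi (pre m))"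
proof (induction m rule: dec_induct)
  case base
  then show ?case by (simp add: pre_1 phi_def del: stake.simps)
next
  case (step m)
  then show ?case using length_phi_stake_Suc[of m] by auto
qed

text \<open>Consecutive values of \<open>length (phi (pre m))\<close> differ by 1 or 2, so these
  values and their successors cover all numbers from 2, the value at \<open>m = 1\<close>,
  onwards.\<close>

lemma ex_phi_stake:
  assumes "n \<ge> 2"
  shows "\<exists>m\<ge>1. n = length (phi (pre m)) \<or> n = Suc (length (phi (pre m)))"
  using assms
proof (induction n rule: dec_induct)
  case base
  show ?case by (rule exI[of _ 1]) (simp add: pre_1 phi_def del: stake.simps)
next
  case (step n)
  then obtain m where "m \<ge> 1" "n = length (phi (pre m)) \<or> n = Suc (length (phi (pre m)))"
    by blast
  then show ?case using length_phi_stake_Suc[of m] by (metis insertE le_SucI singletonD)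
qed

definition Z1 :: "(word \<times> word) list" where
  "Z1 = [([L0, L1], [L1, L0]), ([L0, L2], [L2, L0]), ([L0], [L0])]"

lemma calZ_1: "calZ 1 = set Z1"
proof -
  have "calZ 1 = Dec ([L0, L1, L0, L2, L0, L1, L0]) ([L1, L0, L2, L0, L1, L0, L0])"
    \<comment> \<open>\<open>K = 0\<close> is admissible because \<open>trib 3 = 1\<close>; the word
      \<open>(phi ^^ 3) [L0]\<close> is 0102010.\<close>
    using calZ_eq[of 1 0] pre_1
    by (simp add: Z_at_def left_quotient_def eval_nat_numeral phi_def del: stake.simps)
  also have "\<dots> = set Z1"
    by (subst Dec_code) (auto simp: parikh_def Z1_def)
  finally show ?thesis .
qed

section \<open>The finite closure\<close>

definition pair_succ :: "word \<times> word \<Rightarrow> (word \<times> word) list" where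
  "pair_succ z = phi_phi z @ phi_psi z"

text \<open>The two-bit code \<open>11\<close> terminates a word, which makes the encoding prefix-free.\<close>

fun word_key :: "word \<Rightarrow> bool list \<Rightarrow> bool list" where
  "word_key [] k = True # True # k"
| "word_key (L0 # w) k = False # False # word_key w k"
| "word_key (L1 # w) k = False # True # word_key w k"
| "word_key (L2 # w) k = True # False # word_key w k"

fun pair_key :: "word \<times> word \<Rightarrow> bool list" where
  "pair_key (v, w) = word_key v (word_key w [])"

lemma word_key_inject: "word_key v k = word_key v' k' \<longleftrightarrow> v = v' \<and> k = k'"
proof (induction v arbitrary: v')
  case Nil
  show ?case by (cases "(v', k')" rule: word_key.cases) auto
next
  case (Cons a v)
  then show ?case by (cases a; cases "(v', k')" rule: word_key.cases) auto
qed

lemma inj_pair_key: "inj pair_key"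
  by (rule injI) (auto simp: word_key_inject)

text \<open>Subsets of the list of all pairs are represented by their characteristic bit vectors.\<close>

definition mask :: "'a list \<Rightarrow> 'a set \<Rightarrow> bool list" where
  "mask zs X = map (\<lambda>z. z \<in> X) zs"

fun join :: "bool list \<Rightarrow> bool list \<Rightarrow> bool list" where
  "join (True # xs) (_ # ys) = True # join xs ys"
| "join (False # xs) (y # ys) = y # join xs ys"
| "join _ _ = []"

text \<open>A Boolean vector-matrix product: the rows selected by the first argument are joined onto
  the accumulator \<open>e\<close>.\<close>

fun join_rows :: "bool list \<Rightarrow> bool list list \<Rightarrow> bool list \<Rightarrow> bool list" where
  "join_rows (True # m) (r # rs) e = join_rows m rs (join r e)"
| "join_rows (False # m) (r # rs) e = join_rows m rs e"
| "join_rows _ _ e = e"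

definition trie_mask :: "bool list list \<Rightarrow> trie \<Rightarrow> bool list" where
  "trie_mask ks t = map (\<lambda>k. trie_mem k t) ks"

text \<open>The Boolean matrix of \<open>f\<close> on the listed nodes, which reduces the search
  among sets of pairs to operations on bits.\<close>

definition rows :: "bool list list \<Rightarrow> ('a \<Rightarrow> bool list) \<Rightarrow> ('a \<Rightarrow> 'a list) \<Rightarrow> 'a list \<Rightarrow> bool list list" where
  "rows ks key f zs = map (\<lambda>z. trie_mask ks (trie_of key (f z))) zs"

lemma rows_eq:
  "inj key \<Longrightarrow> rows (map key zs) key f zs = map (\<lambda>z. mask zs (set (f z))) zs"
  by (simp add: rows_def trie_mask_def mask_def trie_mem_trie_of)

lemma join_mask: "join (mask zs A) (mask zs B) = mask zs (A \<union> B)"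
proof (induction zs)
  case (Cons z zs)
  then show ?case by (cases "z \<in> A") (auto simp: mask_def)
qed (simp add: mask_def)

lemma join_rows_mask:
  "join_rows (mask us X) (map (\<lambda>z. mask zs (set (f z))) us) (mask zs Y) =
    mask zs (Y \<union> (\<Union>z\<in>X \<inter> set us. set (f z)))"
proof (induction us arbitrary: Y)
  case (Cons u us)
  have "mask (u # us) X = (u \<in> X) # mask us X" by (simp add: mask_def)
  with Cons show ?case
    by (cases "u \<in> X") (auto simp: join_mask intro!: arg_cong[of _ _ "mask zs"])
qed (simp add: mask_def)

definition mask_succ :: "bool list \<Rightarrow> bool list list \<Rightarrow> bool list list \<Rightarrow> bool list \<Rightarrow> bool list list"
  where "mask_succ e rs rs' m = [join_rows m rs e, join_rows m rs' e]"

text \<open>The seed \<open>([L0], [L0])\<close> is enough, since the other two pairs of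
  \<open>Z1\<close> are reached from it.\<close>

definition explore_pairs :: "((word \<times> word) list \<times> trie \<times> (word \<times> word) list) option" where
  "explore_pairs = explore pair_key pair_succ ([L0], [L0])"

definition explore_masks :: "(word \<times> word) list \<Rightarrow> (bool list list \<times> trie \<times> bool list list) option" where
  "explore_masks zs =
     explore id (mask_succ (mask zs {}) (rows (map pair_key zs) pair_key phi_phi zs)
         (rows (map pair_key zs) pair_key phi_psi zs)) (mask zs (set Z1))"

fun explored :: "nat \<Rightarrow> ('a list \<times> trie \<times> 'a list) option \<Rightarrow> bool" where
  "explored n (Some (_, _, zs)) = (length zs = n)"
| "explored n None = False"

fun check :: "((word \<times> word) list \<times> trie \<times> (word \<times> word) list) option \<Rightarrow> bool" where
  "check (Some (_, _, zs)) = (length zs = 56 \<and> explored 277 (explore_masks zs))"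
| "check None = False"

lemma explored_iff: "explored n r \<longleftrightarrow> (\<exists>ws t zs. r = Some (ws, t, zs) \<and> length zs = n)"
  by (cases "(n, r)" rule: explored.cases) auto

lemma check_iff:
  "check r \<longleftrightarrow>
    (\<exists>ws t zs. r = Some (ws, t, zs) \<and> length zs = 56 \<and> explored 277 (explore_masks zs))"
  by (cases r rule: check.cases) auto

text \<open>Both searches are evaluated here by rewriting: the first yields 56 pairs, over which the
  second finds 277 bit vectors.\<close>

lemma check_explore_pairs: "check explore_pairs"
  by code_simp

theorem theorem8:
  shows "\<exists>Zsuper :: (word \<times> word) set. card Zsuper = 56 \<and>
    (\<exists>Zs :: nat \<Rightarrow> (word \<times> word) set.
       inj_on Zs {1..277} \<and>
       (\<forall>q\<in>{1..277}. Zs q \<subseteq> Zsuper) \<and>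
       (\<forall>n::nat. n \<ge> 1 \<longrightarrow> (\<exists>q\<in>{1..277}. calZ n = Zs q)))"
proof -
  obtain ws t zs where bp: "explore_pairs = Some (ws, t, zs)" and len: "length zs = 56"
    and "explored 277 (explore_masks zs)"
    using check_explore_pairs unfolding check_iff by blast
  then obtain vs u ms where bm: "explore_masks zs = Some (vs, u, ms)" and lenm: "length ms = 277"
    unfolding explored_iff by blast
  note zs = explore_Some[OF inj_pair_key bp[unfolded explore_pairs_def]]
  note ms = explore_Some[OF inj_on_id bm[unfolded explore_masks_def]]
  have card: "card (set zs) = 56" using distinct_card[OF zs(1)] len by simp
  have cl: "(\<Union>z\<in>X. set (phi_phi z)) \<subseteq> set zs" "(\<Union>z\<in>X. set (phi_psi z)) \<subseteq> set zs"
    if "X \<subseteq> set zs" for X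
    using zs(3) that by (force simp: pair_succ_def)+
  have main: "calZ n \<subseteq> set zs \<and> mask zs (calZ n) \<in> set ms" if "n \<ge> 1" for n
    using that
  proof (induction n rule: less_induct)
    case (less n)
    show ?case
    proof (cases "n = 1")
      case True
      \<comment> \<open>The pair 01 over 10 is \<open>phi [L0]\<close> against
        \<open>psi [L0]\<close>. Then \<open>([L1], [L1])\<close> comes from cutting
        \<open>phi [L0]\<close> against itself, and \<open>phi_psi\<close> sends it to 02 over
        20.\<close>
      have "set (phi_psi ([L0], [L0])) \<subseteq> set zs" using zs(3)[OF zs(2)] by (simp add: pair_succ_def)
      then have 1: "([L0, L1], [L1, L0]) \<in> set zs"
        by (simp add: phi_psi_def phi_def psi_def parikh_def)
      have "set (phi_phi ([L0], [L0])) \<subseteq> set zs" using zs(3)[OF zs(2)] by (simp add: pair_succ_def)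
      then have "([L1], [L1]) \<in> set zs"
        by (simp add: phi_phi_def phi_def psi_def parikh_def)
      then have "set (phi_psi ([L1], [L1])) \<subseteq> set zs"
        using zs(3)[of "([L1], [L1])"] by (simp add: pair_succ_def)
      then have "([L0, L2], [L2, L0]) \<in> set zs"
        by (simp add: phi_psi_def phi_def psi_def parikh_def)
      with 1 zs(2) ms(2) True show ?thesis by (simp add: calZ_1[simplified] Z1_def)
    next
      case False
      with less.prems obtain m where m: "m \<ge> 1"
        "n = length (phi (pre m)) \<or> n = Suc (length (phi (pre m)))"
        using ex_phi_stake[of n] by auto
      then have "m < n" using length_phi_stake_gt[of m] by auto
      then have IH: "calZ m \<subseteq> set zs" "mask zs (calZ m) \<in> set ms" using less.IH m(1) by auto
      \<comment> \<open>\<open>join_rows_mask\<close> sees only the pairs listed in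
        \<open>zs\<close>; since \<open>calZ m\<close> lies among them, nothing is lost.\<close>
      then have "calZ m \<inter> set zs = calZ m" by blast
      with ms(3)[OF IH(2)]
      have "mask zs (\<Union>z\<in>calZ m. set (phi_phi z)) \<in> set ms"
        "mask zs (\<Union>z\<in>calZ m. set (phi_psi z)) \<in> set ms"
        by (simp_all add: mask_succ_def rows_eq[OF inj_pair_key] join_rows_mask)
      with cl[OF IH(1)] m(2) show ?thesis using calZ_phi[of m] calZ_psi[of m] by auto
    qed
  qed
  define C where "C = calZ ` {1..}"
  \<comment> \<open>A subset of \<open>set zs\<close> is determined by its bit vector, so there are
    at most as many sets \<open>calZ n\<close> with \<open>n \<ge> 1\<close> as visited
    vectors.\<close>
  have inj: "inj_on (mask zs) (Pow (set zs))"
    by (auto simp: inj_on_def mask_def)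
  have "mask zs ` C \<subseteq> set ms" "C \<subseteq> Pow (set zs)" using main by (auto simp: C_def)
  then have "card C \<le> card (set ms)"
    using card_inj_on_le[of "mask zs" C "set ms"] inj_on_subset[OF inj] by blast
  also have "\<dots> = 277" using distinct_card[OF ms(1)] lenm by simp
  finally have "card C \<le> 277" .
  \<comment> \<open>An upper bound suffices: a smaller family could be padded with further subsets.\<close>
  moreover have "(277 :: nat) \<le> card (Pow (set zs))" by (simp add: card_Pow card)
  ultimately obtain D where D: "C \<subseteq> D" "D \<subseteq> Pow (set zs)" "card D = 277"
    using exists_subset_between[of C 277 "Pow (set zs)"] \<open>C \<subseteq> Pow (set zs)\<close> by auto
  then have "finite D" by (auto intro: finite_subset)
  then obtain Zs :: "nat \<Rightarrow> (word \<times> word) set" where "bij_betw Zs {1..277} D"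
    using ex_bij_betw_nat_finite_1 D(3) by metis
  then have Zs: "inj_on Zs {1..277}" "Zs ` {1..277} = D" by (auto simp: bij_betw_def)
  show ?thesis
  proof (intro exI[of _ "set zs"] exI[of _ Zs] conjI card Zs ballI allI impI)
    show "Zs q \<subseteq> set zs" if "q \<in> {1..277}" for q using Zs(2) D(2) that by blast
    show "\<exists>q\<in>{1..277}. calZ n = Zs q" if "n \<ge> 1" for n
      using Zs(2) D(1) that by (force simp: C_def)
  qed
qed

end
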